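(* Let $\mathfrak X$ be the cross-ratio variety and let $\mathfrak X''=\mathfrak X\setminus\mathfrak X_{\rm CR}$ be endowed with its codimension 2 ${\rm CR}$ structure $\mathcal H=T(\mathfrak X'')\cap\mathbb J\,T(\mathfrak X'')$ inherited from $\mathbb C^3$. This ${\rm CR}$ structure is that of an antiholomorphic ${\rm CR}$ submanifold of $\mathbb C^3$.
   Context: $\mathbb J$ is the natural complex structure of $\mathbb C^3$. The cross-ratio variety $\mathfrak X$ is the set of $(\mathbb X_1,\mathbb X_2,\mathbb X_3)\in(\mathbb C\setminus\{0\})^3$ with $|\mathbb X_3|^2=|\mathbb X_2|^2/|\mathbb X_1|^2$ and $2|\mathbb X_1|^2\Re(\mathbb X_3)=|\mathbb X_1|^2+|\mathbb X_2|^2-2\Re(\mathbb X_1)-2\Re(\mathbb X_2)+1$. The ${\rm CR}$ singular set is $$\mathfrak X_{\rm CR}=\{(\mathbb X_1,\mathbb X_2,\mathbb X_3)\in\mathfrak X:\ \mathbb X_1+\mathbb X_2=1,\ 1/\mathbb X_2+1/\mathbb X_3=1,\ \mathbb X_3+1/\mathbb X_1=1\}.$$ It is known that $\mathfrak X''=\mathfrak X\setminus\mathfrak X_{\rm CR}$ is a smooth real 4-dimensional submanifold of $\mathbb C^3$ and that $\mathcal H=T(\mathfrak X'')\cap\mathbb JT(\mathfrak X'')$ is a smooth subbundle of real rank 2, hence a ${\rm CR}$ structure of codimension 2. A submanifold $M$ of a complex manifold $(N,J)$ with $\dim_{\mathbb C}N=p+s$, $\dim_{\mathbb R}M=2p+s$,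 for which $\mathcal H=T(M)\cap J(T(M))$ is a smooth subbundle of real rank $2p$, is called an antiholomorphic ${\rm CR}$ submanifold of $N$ if there is a subbundle $\mathcal V$ of $T(M)$ with $T(M)=\mathcal H\oplus\mathcal V$ and $J(\mathcal V)\cap T(M)=\{0\}$. *)

theory Defs
  imports "HOL-Analysis.Analysis"
begin

section \<open>Smooth maps and submanifolds of Euclidean spaces\<close>

text \<open>Derivatives are full derivatives (filter \<open>at x\<close>), so these notions are meant for open
  domains \<open>S\<close> only; this is how they are used below.\<close>

primrec Ck_on :: "nat \<Rightarrow> 'a::euclidean_space set \<Rightarrow> ('a \<Rightarrow> 'b::euclidean_space) \<Rightarrow> bool" where
  "Ck_on 0 S f \<longleftrightarrow> continuous_on S f"
| "Ck_on (Suc k) S f \<longleftrightarrow>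
     (\<forall>x\<in>S. f differentiable (at x)) \<and> (\<forall>v. Ck_on k S (\<lambda>x. frechet_derivative f (at x) v))"

definition smooth_on :: "'a::euclidean_space set \<Rightarrow> ('a \<Rightarrow> 'b::euclidean_space) \<Rightarrow> bool" where
  "smooth_on S f \<longleftrightarrow> (\<forall>k. Ck_on k S f)"

text \<open>Embedded submanifolds of real dimension \<open>k\<close>, given by slice charts: around each point of \<open>M\<close>
  there is a diffeomorphism between open sets of the ambient space that straightens \<open>M\<close> to a
  \<open>k\<close>-dimensional linear subspace.\<close>

definition smooth_submanifold :: "nat \<Rightarrow> 'a::euclidean_space set \<Rightarrow> bool" where
  "smooth_submanifold k M \<longleftrightarrow>
     (\<forall>x\<in>M. \<exists>U W \<phi> \<psi> L. open U \<and> x \<in> U \<and> open W \<and>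
        homeomorphism U W \<phi> \<psi> \<and> smooth_on U \<phi> \<and> smooth_on W \<psi> \<and>
        subspace (L :: 'a set) \<and> dim L = k \<and> \<phi> ` (M \<inter> U) = W \<inter> L)"

definition tangent_space :: "'a::euclidean_space set \<Rightarrow> 'a \<Rightarrow> 'a set" where
  "tangent_space M x =
     {v. \<exists>\<gamma> e. e > 0 \<and> smooth_on {-e<..<e} \<gamma> \<and> \<gamma> ` {-e<..<e::real} \<subseteq> M \<and>
           \<gamma> 0 = x \<and> (\<gamma> has_vector_derivative v) (at 0)}"

text \<open>A subbundle of \<open>T(M)\<close> is a family of fibres \<open>D x\<close>, \<open>x \<in> M\<close>, admitting smooth local frames.
  As \<open>M\<close> is embedded, a smooth local vector field along \<open>M\<close> is, after shrinking its domain,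
  the restriction of a smooth map on an open set of the ambient space.  The \<open>r\<close> spanning fields
  are linearly independent at each point because the fibre has dimension \<open>r\<close>.\<close>

definition smooth_subbundle ::
    "nat \<Rightarrow> 'a::euclidean_space set \<Rightarrow> ('a \<Rightarrow> 'a set) \<Rightarrow> bool" where
  "smooth_subbundle r M D \<longleftrightarrow>
     (\<forall>x\<in>M. D x \<subseteq> tangent_space M x \<and> dim (D x) = r) \<and>
     (\<forall>x\<in>M. \<exists>U X. open U \<and> x \<in> U \<and> (\<forall>i<r. smooth_on U (X i)) \<and>
        (\<forall>y\<in>M \<inter> U. D y = span ((\<lambda>i::nat. X i y) ` {..<r})))"


section \<open>Antiholomorphic CR submanifolds of complex coordinate space\<close>

definition cstruct :: "complex ^ 'n \<Rightarrow> complex ^ 'n" where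
  "cstruct v = \<i> *s v"

definition CR_bundle :: "(complex ^ 'n::finite) set \<Rightarrow> complex ^ 'n \<Rightarrow> (complex ^ 'n) set" where
  "CR_bundle M x = tangent_space M x \<inter> cstruct ` tangent_space M x"

text \<open>The complex manifold \<open>(N, J)\<close> is complex coordinate space with multiplication by \<open>\<i>\<close>.
  The rank of the complementary bundle is forced to be \<open>s\<close> by the dimensions of
  \<open>T(M)\<close> and \<open>H\<close>.\<close>

definition antiholomorphic_CR_submanifold ::
    "nat \<Rightarrow> nat \<Rightarrow> (complex ^ 'n::finite) set \<Rightarrow> bool" where
  "antiholomorphic_CR_submanifold p s M \<longleftrightarrow>
     CARD('n) = p + s \<and>
     smooth_submanifold (2 * p + s) M \<and>
     smooth_subbundle (2 * p) M (CR_bundle M) \<and>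
     (\<exists>V. smooth_subbundle s M V \<and>
        (\<forall>x\<in>M. tangent_space M x = {h + v | h v. h \<in> CR_bundle M x \<and> v \<in> V x} \<and>
               CR_bundle M x \<inter> V x = {0} \<and>
               cstruct ` V x \<inter> tangent_space M x = {0}))"


section \<open>The cross-ratio variety\<close>

definition cross_ratio_variety :: "(complex ^ 3) set" where
  "cross_ratio_variety =
     {X. X $ 1 \<noteq> 0 \<and> X $ 2 \<noteq> 0 \<and> X $ 3 \<noteq> 0 \<and>
         (cmod (X $ 3))\<^sup>2 = (cmod (X $ 2))\<^sup>2 / (cmod (X $ 1))\<^sup>2 \<and>
         2 * (cmod (X $ 1))\<^sup>2 * Re (X $ 3) =
           (cmod (X $ 1))\<^sup>2 + (cmod (X $ 2))\<^sup>2 - 2 * Re (X $ 1) - 2 * Re (X $ 2) + 1}"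

definition cross_ratio_CR_singular_set :: "(complex ^ 3) set" where
  "cross_ratio_CR_singular_set =
     {X \<in> cross_ratio_variety.
         X $ 1 + X $ 2 = 1 \<and> 1 / X $ 2 + 1 / X $ 3 = 1 \<and> X $ 3 + 1 / X $ 1 = 1}"

end

theory Submission
  imports Defs
begin

text \<open>
  Write \<open>M\<close> for the cross-ratio variety without its singular set. It is the zero set of two real
  polynomials \<open>\<rho>\<close>, \<open>\<sigma>\<close> in an open subset of \<open>\<complex>\<^sup>3\<close>. With \<open>\<alpha> = \<partial>\<rho>\<close> and \<open>\<beta> = \<partial>\<sigma>\<close> the real differentials are
  \<open>2 Re \<alpha>\<close> and \<open>2 Re \<beta>\<close>, so tangent vectors of \<open>M\<close> are those on which \<open>\<alpha>\<close> and \<open>\<beta>\<close> are imaginary, and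
  the holomorphic tangent space \<open>H\<close> is their common complex kernel. All assertions reduce to the
  linear independence of \<open>\<alpha>\<close> and \<open>\<beta>\<close> over \<open>\<complex>\<close>, i.e. to \<open>Z = \<alpha> \<times> \<beta> \<noteq> 0\<close>. At points with nonzero
  coordinates this cross product vanishes only where the equations of the singular set hold
  (lemma \<open>generic_on_nonsingular\<close>).

  Given independence, \<open>H\<close> is the complex line through \<open>Z\<close>. A complement \<open>V\<close> of \<open>H\<close> in the tangent space
  always satisfies \<open>\<i> V \<inter> T = {0}\<close>: if \<open>v\<close> and \<open>\<i> v\<close> are both tangent, then \<open>v \<in> H \<inter> V\<close>. It remains to give a
  complement with a smooth frame, and \<open>\<i> (\<beta> \<times> Z\<^sup>*)\<close>, \<open>\<i> (Z\<^sup>* \<times> \<alpha>)\<close> with \<open>Z\<^sup>*\<close> the conjugate of \<open>Z\<close> are such a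
  frame (theorem \<open>antiholomorphic_zero_set\<close>).

  The analytic part is the regular value theorem in the smooth category: zero sets of two functions
  with independent differentials are submanifolds whose tangent spaces are the kernels of the
  differentials. The inverse function theorem gives a differentiable inverse of a straightening map.
  The map is chosen so that its derivative can be inverted by Cramer's rule, which makes the inverse the
  solution of a differential equation with smooth right-hand side, hence smooth
  (lemmas \<open>smooth_on_bootstrap\<close> and \<open>straightening_chart\<close>).
\<close>

section \<open>Calculus of smooth maps\<close>

lemma Ck_on_cong:
  assumes "open S" "\<And>x. x \<in> S \<Longrightarrow> f x = g x"
  shows "Ck_on k S f \<longleftrightarrow> Ck_on k S g"
  using assms(2)
proof (induction k arbitrary: f g)
  case 0
  then show ?case by (simp cong: continuous_on_cong)
next
  case (Suc k)
  have transfer: "(f has_derivative D) (at x) \<longleftrightarrow> (g has_derivative D) (at x)" if "x \<in> S" for x D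
    using Suc.prems has_derivative_transform_within_open[OF _ assms(1) that] by metis
  have fd: "frechet_derivative f (at x) = frechet_derivative g (at x)" if "x \<in> S" for x
    unfolding frechet_derivative_def using transfer[OF that] by simp
  have "f differentiable (at x) \<longleftrightarrow> g differentiable (at x)" if "x \<in> S" for x
    unfolding differentiable_def using transfer[OF that] by simp
  moreover have "Ck_on k S (\<lambda>x. frechet_derivative f (at x) v) \<longleftrightarrow>
      Ck_on k S (\<lambda>x. frechet_derivative g (at x) v)" for v
    by (rule Suc.IH) (simp add: fd)
  ultimately show ?case by simp
qed

text \<open>Computed derivatives replace \<^const>\<open>frechet_derivative\<close>. Openness of \<open>S\<close> enters because the two
  families of derivatives agree only on \<open>S\<close>.\<close>
lemma Ck_on_SucI:
  assumes "open S" "\<And>x. x \<in> S \<Longrightarrow> (f has_derivative f' x) (at x)" "\<And>v. Ck_on k S (\<lambda>x. f' x v)"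
  shows "Ck_on (Suc k) S f"
proof -
  have "frechet_derivative f (at x) = f' x" if "x \<in> S" for x
    using frechet_derivative_at[OF assms(2)[OF that]] by simp
  then have "Ck_on k S (\<lambda>x. frechet_derivative f (at x) v)" for v
    using Ck_on_cong[OF assms(1), of "\<lambda>x. frechet_derivative f (at x) v" "\<lambda>x. f' x v" k] assms(3)[of v]
    by simp
  then show ?thesis using assms(2) by (auto simp: differentiable_def)
qed

lemma Ck_on_Suc_derivative:
  assumes "Ck_on (Suc k) S f" "x \<in> S"
  shows "(f has_derivative frechet_derivative f (at x)) (at x)"
  using assms by (simp add: frechet_derivative_works)

lemma Ck_on_SucD: "Ck_on (Suc k) S f \<Longrightarrow> Ck_on k S f"
proof (induction k arbitrary: f)
  case 0
  then show ?case
    by (auto intro!: continuous_at_imp_continuous_on differentiable_imp_continuous_within)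
next
  case (Suc k)
  then show ?case using Ck_on.simps(2)[of "Suc k" S f] Ck_on.simps(2)[of k S f] by blast
qed

lemma Ck_on_subset: "Ck_on k T f \<Longrightarrow> S \<subseteq> T \<Longrightarrow> Ck_on k S f"
  by (induction k arbitrary: f) (auto intro: continuous_on_subset)

lemma Ck_on_const: "open S \<Longrightarrow> Ck_on k S (\<lambda>x. c)"
proof (induction k arbitrary: c)
  case (Suc k)
  show ?case
    by (rule Ck_on_SucI[where f' = "\<lambda>x v. 0", OF Suc.prems])
      (auto intro: Suc)
qed auto

lemma Ck_on_bounded_linear:
  assumes "open S" "bounded_linear f"
  shows "Ck_on k S f"
proof (cases k)
  case 0
  then show ?thesis using linear_continuous_on[OF assms(2)] by simp
next
  case (Suc n)
  show ?thesis unfolding Suc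
    by (rule Ck_on_SucI[where f' = "\<lambda>x. f", OF assms(1)])
      (auto intro: Ck_on_const assms bounded_linear_imp_has_derivative)
qed

lemma Ck_on_add:
  assumes "open S" "Ck_on k S f" "Ck_on k S g"
  shows "Ck_on k S (\<lambda>x. f x + g x)"
  using assms(2,3)
proof (induction k arbitrary: f g)
  case 0
  then show ?case by (auto intro: continuous_intros)
next
  case (Suc k)
  show ?case
    by (rule Ck_on_SucI[OF assms(1) has_derivative_add[OF Suc.prems[THEN Ck_on_Suc_derivative]]])
      (use Suc in auto)
qed

lemma Ck_on_sum:
  assumes "open S" "\<And>i. i \<in> I \<Longrightarrow> Ck_on k S (f i)"
  shows "Ck_on k S (\<lambda>x. \<Sum>i\<in>I. f i x)"
  using assms(2)
  by (induction I rule: infinite_finite_induct) (auto intro: Ck_on_add Ck_on_const assms(1))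

text \<open>One induction covers every product used below (real and complex multiplication, scaling, inner
  product, complex cross product): the product rule expresses the derivative by two products of
  the same kind.\<close>
lemma Ck_on_bilinear:
  assumes "open S" "bounded_bilinear h" "Ck_on k S f" "Ck_on k S g"
  shows "Ck_on k S (\<lambda>x. h (f x) (g x))"
  using assms(3,4)
proof (induction k arbitrary: f g)
  case 0
  then show ?case using bounded_bilinear.continuous_on[OF assms(2)] by auto
next
  case (Suc k)
  note lower = Suc.prems[THEN Ck_on_SucD]
  show ?case
    by (rule Ck_on_SucI[OF assms(1)
          bounded_bilinear.FDERIV[OF assms(2) Suc.prems[THEN Ck_on_Suc_derivative]]])
      (use Suc lower in \<open>auto intro!: Ck_on_add assms(1) Suc.IH\<close>)
qed

text \<open>In the chain rule the outer derivative is applied to a direction that varies with the point,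
  whereas \<^const>\<open>Ck_on\<close> controls derivatives in fixed directions only. Expanding the varying direction
  in the standard basis gives a sum of products to which the induction hypothesis applies.\<close>
lemma Ck_on_compose:
  fixes f :: "'a::euclidean_space \<Rightarrow> 'b::euclidean_space"
    and g :: "'b \<Rightarrow> 'c::euclidean_space"
  assumes "open S" "open T" "f ` S \<subseteq> T" "Ck_on k S f" "Ck_on k T g"
  shows "Ck_on k S (\<lambda>x. g (f x))"
  using assms(4,5)
proof (induction k arbitrary: g)
  case 0
  then show ?case using assms(3) continuous_on_compose2[of T g S f] by auto
next
  case (Suc k)
  let ?F = "\<lambda>x. frechet_derivative f (at x)" and ?G = "\<lambda>y. frechet_derivative g (at y)"
  have D: "((\<lambda>x. g (f x)) has_derivative (\<lambda>v. \<Sum>b\<in>Basis. (?F x v \<bullet> b) *\<^sub>R ?G (f x) b)) (at x)"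
    if "x \<in> S" for x
  proof -
    have g: "(g has_derivative ?G (f x)) (at (f x))"
      using Ck_on_Suc_derivative[OF Suc.prems(2)] assms(3) that by auto
    then have "linear (?G (f x))" using has_derivative_linear by blast
    then have "?G (f x) (\<Sum>b\<in>Basis. (u \<bullet> b) *\<^sub>R b) = (\<Sum>b\<in>Basis. (u \<bullet> b) *\<^sub>R ?G (f x) b)" for u
      by (simp only: linear_sum linear_scale)
    then have "(\<lambda>v. ?G (f x) (?F x v)) = (\<lambda>v. \<Sum>b\<in>Basis. (?F x v \<bullet> b) *\<^sub>R ?G (f x) b)"
      unfolding euclidean_representation by (intro ext)
    then show ?thesis
      using has_derivative_compose[OF Ck_on_Suc_derivative[OF Suc.prems(1) that] g] by (simp only:)
  qed
  have lower: "Ck_on k S f" by (rule Ck_on_SucD[OF Suc.prems(1)])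
  show ?case
  proof (rule Ck_on_SucI[OF assms(1) D])
    fix v
    show "Ck_on k S (\<lambda>x. \<Sum>b\<in>Basis. (?F x v \<bullet> b) *\<^sub>R ?G (f x) b)"
    proof (rule Ck_on_sum[OF assms(1)])
      fix b :: 'b
      have "Ck_on k S (\<lambda>x. ?F x v)" using Suc.prems(1) by simp
      then have "Ck_on k S (\<lambda>x. ?F x v \<bullet> b)"
        by (intro Ck_on_bilinear[OF assms(1) bounded_bilinear_inner] Ck_on_const assms(1))
      moreover have "Ck_on k S (\<lambda>x. ?G (f x) b)"
        using Suc.IH[OF lower] Suc.prems(2) by auto
      ultimately show "Ck_on k S (\<lambda>x. (?F x v \<bullet> b) *\<^sub>R ?G (f x) b)"
        by (rule Ck_on_bilinear[OF assms(1) bounded_bilinear_scaleR])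
    qed
  qed
qed

lemma Ck_on_real_inverse: "Ck_on k (- {0::real}) inverse"
proof (induction k)
  case 0
  then show ?case by (auto intro!: continuous_intros)
next
  case (Suc k)
  have "Ck_on k (- {0}) (\<lambda>x::real. (inverse x * inverse x) * (- v))" for v
    by (intro Ck_on_bilinear[OF _ bounded_bilinear_mult] Ck_on_const Suc) auto
  moreover have "(inverse has_derivative (\<lambda>v. (inverse x * inverse x) * (- v))) (at x)"
    if "x \<in> - {0}" for x :: real
    using that by (auto intro!: derivative_eq_intros)
  ultimately show ?case by (intro Ck_on_SucI[of "- {0::real}"]) auto
qed

named_theorems smooth_intros

lemma smooth_on_cong: "open S \<Longrightarrow> (\<And>x. x \<in> S \<Longrightarrow> f x = g x) \<Longrightarrow> smooth_on S f \<longleftrightarrow> smooth_on S g"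
  unfolding smooth_on_def using Ck_on_cong by blast

lemma smooth_on_subset: "smooth_on T f \<Longrightarrow> S \<subseteq> T \<Longrightarrow> smooth_on S f"
  unfolding smooth_on_def using Ck_on_subset by blast

lemma smooth_on_const [smooth_intros]: "open S \<Longrightarrow> smooth_on S (\<lambda>x. c)"
  by (simp add: smooth_on_def Ck_on_const)

lemma smooth_on_add [smooth_intros]:
  "open S \<Longrightarrow> smooth_on S f \<Longrightarrow> smooth_on S g \<Longrightarrow> smooth_on S (\<lambda>x. f x + g x)"
  by (simp add: smooth_on_def Ck_on_add)

lemma smooth_on_sum [smooth_intros]:
  "open S \<Longrightarrow> (\<And>i. i \<in> I \<Longrightarrow> smooth_on S (f i)) \<Longrightarrow> smooth_on S (\<lambda>x. \<Sum>i\<in>I. f i x)"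
  by (simp add: smooth_on_def Ck_on_sum)

lemma smooth_on_bilinear:
  "open S \<Longrightarrow> bounded_bilinear h \<Longrightarrow> smooth_on S f \<Longrightarrow> smooth_on S g \<Longrightarrow> smooth_on S (\<lambda>x. h (f x) (g x))"
  by (simp add: smooth_on_def Ck_on_bilinear)

lemmas smooth_on_mult [smooth_intros] = smooth_on_bilinear[OF _ bounded_bilinear_mult]
lemmas smooth_on_scaleR [smooth_intros] = smooth_on_bilinear[OF _ bounded_bilinear_scaleR]

lemma smooth_on_compose:
  "open S \<Longrightarrow> open T \<Longrightarrow> f ` S \<subseteq> T \<Longrightarrow> smooth_on S f \<Longrightarrow> smooth_on T g \<Longrightarrow>
    smooth_on S (\<lambda>x. g (f x))"
  unfolding smooth_on_def using Ck_on_compose by blast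

lemma smooth_on_bounded_linear: "open S \<Longrightarrow> bounded_linear f \<Longrightarrow> smooth_on S f"
  by (simp add: smooth_on_def Ck_on_bounded_linear)

lemma smooth_on_bounded_linear_compose:
  "open S \<Longrightarrow> bounded_linear h \<Longrightarrow> smooth_on S f \<Longrightarrow> smooth_on S (\<lambda>x. h (f x))"
  by (rule smooth_on_compose[where T = UNIV]) (auto intro: smooth_on_bounded_linear)

lemma smooth_on_minus [smooth_intros]:
  "open S \<Longrightarrow> smooth_on S f \<Longrightarrow> smooth_on S (\<lambda>x. - f x)"
  by (rule smooth_on_bounded_linear_compose[OF _ bounded_linear_minus[OF bounded_linear_ident]])

lemma smooth_on_diff [smooth_intros]:
  "open S \<Longrightarrow> smooth_on S f \<Longrightarrow> smooth_on S g \<Longrightarrow> smooth_on S (\<lambda>x. f x - g x)"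
  using smooth_on_add[of S f "\<lambda>x. - g x"] smooth_on_minus[of S g] by simp

lemma smooth_on_divide [smooth_intros]:
  fixes f g :: "'a::euclidean_space \<Rightarrow> real"
  assumes "open S" "smooth_on S f" "smooth_on S g" "\<And>x. x \<in> S \<Longrightarrow> g x \<noteq> 0"
  shows "smooth_on S (\<lambda>x. f x / g x)"
proof -
  have "smooth_on S (\<lambda>x. inverse (g x))"
    by (rule smooth_on_compose[where T = "- {0}"])
      (use assms in \<open>auto simp: smooth_on_def Ck_on_real_inverse\<close>)
  then show ?thesis
    unfolding divide_inverse by (intro smooth_on_mult assms)
qed

lemma smooth_on_derivative:
  assumes "open S" "smooth_on S f" "\<And>x. x \<in> S \<Longrightarrow> (f has_derivative f' x) (at x)"
  shows "smooth_on S (\<lambda>x. f' x v)"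
proof -
  have "smooth_on S (\<lambda>x. frechet_derivative f (at x) v)"
    using assms(2) Ck_on.simps(2) unfolding smooth_on_def by blast
  moreover have "frechet_derivative f (at x) v = f' x v" if "x \<in> S" for x
    using frechet_derivative_at[OF assms(3)[OF that]] by simp
  ultimately show ?thesis using smooth_on_cong[OF assms(1)] by (metis (no_types, lifting))
qed

lemma smooth_onI_derivative:
  assumes "open S" "\<And>x. x \<in> S \<Longrightarrow> (f has_derivative f' x) (at x)" "\<And>v. smooth_on S (\<lambda>x. f' x v)"
  shows "smooth_on S f"
  using Ck_on_SucD[OF Ck_on_SucI[OF assms(1,2)]] assms(3) unfolding smooth_on_def by blast

lemma smooth_on_imp_continuous_on: "smooth_on S f \<Longrightarrow> continuous_on S f"
  unfolding smooth_on_def using Ck_on.simps(1) by blast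

text \<open>A differentiable map that solves a differential equation with smooth right-hand side is smooth:
  if \<open>g\<close> is \<open>C\<^sup>k\<close>, then so is \<open>F w \<circ> g\<close>, which is the derivative
  of \<open>g\<close> in direction \<open>w\<close>, so that \<open>g\<close> is of class \<open>k + 1\<close>.
  This is how the inverse function in the inverse function theorem is seen to be smooth.\<close>
lemma smooth_on_bootstrap:
  fixes g :: "'a::euclidean_space \<Rightarrow> 'b::euclidean_space"
  assumes "open V" "open U" "g ` V \<subseteq> U"
    and der: "\<And>y. y \<in> V \<Longrightarrow> (g has_derivative (\<lambda>w. F w (g y))) (at y)"
    and F: "\<And>w. smooth_on U (F w)"
  shows "smooth_on V g"
proof -
  have "Ck_on k V g" for k
  proof (induction k)
    case 0
    show ?case
      using der by (auto intro!: continuous_at_imp_continuous_on has_derivative_continuous)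
  next
    case (Suc k)
    have "Ck_on k V (\<lambda>y. F w (g y))" for w
      using Ck_on_compose[OF assms(1-3) Suc] F unfolding smooth_on_def by blast
    then show ?case using Ck_on_SucI[OF assms(1) der] by blast
  qed
  then show ?thesis by (simp add: smooth_on_def)
qed

section \<open>Zero sets of two independent equations\<close>

lemma mem_span_pair: "v \<in> span {a, b} \<longleftrightarrow> (\<exists>s t. v = s *\<^sub>R a + t *\<^sub>R b)"
  for a b v :: "'a::real_vector"
  by (auto simp: span_insert span_singleton algebra_simps) 

lemma dim_span_pair:
  fixes a b :: "'a::euclidean_space"
  assumes "\<And>s t. s *\<^sub>R a + t *\<^sub>R b = 0 \<Longrightarrow> s = 0 \<and> t = 0"
  shows "dim (span {a, b}) = 2"
proof -
  have "b \<noteq> 0" using assms[of 0 1] by auto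
  have notin: "a \<notin> span {b}"
  proof
    assume "a \<in> span {b}"
    then obtain t where "a = t *\<^sub>R b" by (auto simp: span_singleton)
    then show False using assms[of 1 "- t"] by simp
  qed
  then have "a \<noteq> b" by (auto intro: span_base)
  moreover have "independent {a, b}" using \<open>b \<noteq> 0\<close> notin by (simp add: independent_insert)
  ultimately show ?thesis by (simp add: dim_eq_card_independent)
qed

text \<open>Two real equations with linearly independent differentials \<open>d1 x\<close>, \<open>d2 x\<close>. Independence is
  stated through dual vectors, which are what the straightening chart is built from.\<close>
locale regular_zero_set =
  fixes S :: "'a::euclidean_space set" and \<rho>1 \<rho>2 :: "'a \<Rightarrow> real" and d1 d2 :: "'a \<Rightarrow> 'a \<Rightarrow> real"
  assumes open_S: "open S"
    and smooth_\<rho>1: "smooth_on S \<rho>1" and smooth_\<rho>2: "smooth_on S \<rho>2"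
    and der_\<rho>1: "x \<in> S \<Longrightarrow> (\<rho>1 has_derivative d1 x) (at x)"
    and der_\<rho>2: "x \<in> S \<Longrightarrow> (\<rho>2 has_derivative d2 x) (at x)"
    and dual_vectors:
      "x \<in> S \<Longrightarrow> \<exists>a1 a2. d1 x a1 = 1 \<and> d2 x a1 = 0 \<and> d1 x a2 = 0 \<and> d2 x a2 = 1"
begin

definition zero_set :: "'a set" where
  "zero_set = {x \<in> S. \<rho>1 x = 0 \<and> \<rho>2 x = 0}"

lemma bounded_linear_d: "x \<in> S \<Longrightarrow> bounded_linear (d1 x)" "x \<in> S \<Longrightarrow> bounded_linear (d2 x)"
  using der_\<rho>1 der_\<rho>2 by (auto dest: has_derivative_bounded_linear)

lemma smooth_d: "smooth_on S (\<lambda>x. d1 x v)" "smooth_on S (\<lambda>x. d2 x v)"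
  using smooth_on_derivative[OF open_S smooth_\<rho>1 der_\<rho>1] smooth_on_derivative[OF open_S smooth_\<rho>2 der_\<rho>2]
  by auto

text \<open>The dual vectors span a two-dimensional complement of the kernel.\<close>

lemma dim_kernel:
  assumes "x \<in> S"
  shows "dim {v. d1 x v = 0 \<and> d2 x v = 0} + 2 = DIM('a)"
proof -
  interpret D1: bounded_linear "d1 x" by (rule bounded_linear_d[OF assms])
  interpret D2: bounded_linear "d2 x" by (rule bounded_linear_d[OF assms])
  obtain a1 a2 where a: "d1 x a1 = 1" "d2 x a1 = 0" "d1 x a2 = 0" "d2 x a2 = 1"
    using dual_vectors[OF assms] by blast
  let ?K = "{v. d1 x v = 0 \<and> d2 x v = 0}" and ?A = "span {a1, a2}"
  have K: "subspace ?K" by (auto simp: subspace_def D1.add D2.add D1.scaleR D2.scaleR)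
  have "?K \<inter> ?A \<subseteq> {0}"
  proof
    fix v assume v: "v \<in> ?K \<inter> ?A"
    then obtain s t where "v = s *\<^sub>R a1 + t *\<^sub>R a2" using v mem_span_pair[of v a1 a2] by blast
    then show "v \<in> {0}" using v a by (simp add: D1.add D2.add D1.scaleR D2.scaleR)
  qed
  then have "dim (?K \<inter> ?A) = 0" by simp
  moreover have "dim {u + w | u w. u \<in> ?K \<and> w \<in> ?A} = DIM('a)"
  proof -
    have "{u + w | u w. u \<in> ?K \<and> w \<in> ?A} = UNIV"
    proof -
      have "\<exists>u w. v = u + w \<and> u \<in> ?K \<and> w \<in> ?A" for v
      proof (intro exI conjI)
        let ?w = "d1 x v *\<^sub>R a1 + d2 x v *\<^sub>R a2"
        show "v = (v - ?w) + ?w" by simp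
        show "v - ?w \<in> ?K"
          using a by (simp add: D1.add D2.add D1.diff D2.diff D1.scaleR D2.scaleR)
        show "?w \<in> ?A" by (intro span_add span_mul span_base) auto
      qed
      then show ?thesis by blast
    qed
    then show ?thesis by simp
  qed
  moreover have "dim ?A = 2"
  proof (rule dim_span_pair)
    fix s t assume 0: "s *\<^sub>R a1 + t *\<^sub>R a2 = 0"
    have "d1 x (s *\<^sub>R a1 + t *\<^sub>R a2) = 0" "d2 x (s *\<^sub>R a1 + t *\<^sub>R a2) = 0"
      unfolding 0 by (simp_all add: D1.zero D2.zero)
    then show "s = 0 \<and> t = 0" using a by (simp add: D1.add D2.add D1.scaleR D2.scaleR)
  qed
  ultimately show ?thesis
    using dim_sums_Int[OF K subspace_span, of "{a1, a2}"] by linarith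
qed

text \<open>The map \<open>\<phi> x = x + (\<rho>1 x - d1 x0 x) a1 + (\<rho>2 x - d2 x0 x) a2\<close>, where \<open>a1\<close>, \<open>a2\<close> are dual to the
  differentials at \<open>x0\<close>, turns \<open>\<rho>1\<close>, \<open>\<rho>2\<close> into the linear forms \<open>d1 x0\<close>, \<open>d2 x0\<close>, and its derivative at
  \<open>x0\<close> is the identity. It differs from the identity by a term of rank at most two, so that its derivative is
  inverted by solving a \<open>2 \<times> 2\<close> system. Cramer's rule then displays the derivative of the local
  inverse as a smooth expression in that inverse.\<close>

lemma straightening_chart:
  assumes "x0 \<in> S"
  obtains U W \<phi> \<psi> where "open U" "x0 \<in> U" "U \<subseteq> S" "open W" "homeomorphism U W \<phi> \<psi>"
    "smooth_on U \<phi>" "smooth_on W \<psi>" "(\<psi> has_derivative (\<lambda>v. v)) (at (\<phi> x0))"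
    "\<And>x. x \<in> U \<Longrightarrow> d1 x0 (\<phi> x) = \<rho>1 x" "\<And>x. x \<in> U \<Longrightarrow> d2 x0 (\<phi> x) = \<rho>2 x"
proof -
  interpret l1: bounded_linear "d1 x0" by (rule bounded_linear_d[OF assms])
  interpret l2: bounded_linear "d2 x0" by (rule bounded_linear_d[OF assms])
  obtain a1 a2 where a: "d1 x0 a1 = 1" "d2 x0 a1 = 0" "d1 x0 a2 = 0" "d2 x0 a2 = 1"
    using dual_vectors[OF assms] by blast
  define \<phi> where "\<phi> x = x + (\<rho>1 x - d1 x0 x) *\<^sub>R a1 + (\<rho>2 x - d2 x0 x) *\<^sub>R a2" for x
  define \<phi>' where "\<phi>' x v = v + (d1 x v - d1 x0 v) *\<^sub>R a1 + (d2 x v - d2 x0 v) *\<^sub>R a2" for x v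
  \<comment> \<open>The inverse of \<open>\<phi>' x\<close> is \<open>\<lambda>w. F w x\<close>; \<open>c1\<close> and \<open>c2\<close> solve the \<open>2 \<times> 2\<close> system with determinant \<open>\<Delta> x\<close>.\<close>
  define \<Delta> where "\<Delta> x = d1 x a1 * d2 x a2 - d1 x a2 * d2 x a1" for x
  define c1 where "c1 w x = ((d1 x0 w - d1 x w) * d2 x a2 - (d2 x0 w - d2 x w) * d1 x a2) / \<Delta> x" for w x
  define c2 where "c2 w x = ((d2 x0 w - d2 x w) * d1 x a1 - (d1 x0 w - d1 x w) * d2 x a1) / \<Delta> x" for w x
  define F where "F w x = w + c1 w x *\<^sub>R a1 + c2 w x *\<^sub>R a2" for w x
  define U0 where "U0 = {x \<in> S. \<Delta> x \<noteq> 0}"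
  have smooth_l: "smooth_on S (d1 x0)" "smooth_on S (d2 x0)"
    by (intro smooth_on_bounded_linear open_S bounded_linear_d assms)+
  have smooth_id: "smooth_on S (\<lambda>x. x)"
    by (rule smooth_on_bounded_linear[OF open_S bounded_linear_ident])
  have smooth_\<phi>: "smooth_on S \<phi>"
    unfolding \<phi>_def by (intro smooth_intros open_S smooth_l smooth_id smooth_\<rho>1 smooth_\<rho>2)
  have smooth_\<Delta>: "smooth_on S \<Delta>"
    unfolding \<Delta>_def by (intro smooth_intros open_S smooth_d)
  have "U0 = S \<inter> \<Delta> -` (- {0})" by (auto simp: U0_def)
  then have "open U0"
    using continuous_open_preimage[OF smooth_on_imp_continuous_on[OF smooth_\<Delta>] open_S, of "- {0}"]
    by (simp add: open_Compl)
  have "U0 \<subseteq> S" unfolding U0_def by blast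
  have "x0 \<in> U0" using assms a by (simp add: U0_def \<Delta>_def)
  have smooth_F: "smooth_on U0 (F w)" for w
  proof -
    note smooth_d' = smooth_d[THEN smooth_on_subset[OF _ \<open>U0 \<subseteq> S\<close>]]
    show ?thesis
      unfolding F_def c1_def c2_def
      by (intro smooth_intros \<open>open U0\<close> smooth_d' smooth_on_subset[OF smooth_\<Delta> \<open>U0 \<subseteq> S\<close>])
        (auto simp: U0_def)
  qed
  have \<phi>'_F: "\<phi>' x (F w x) = w" if "x \<in> U0" for x w
  proof -
    interpret D1: bounded_linear "d1 x" by (rule bounded_linear_d) (use that U0_def in auto)
    interpret D2: bounded_linear "d2 x" by (rule bounded_linear_d) (use that U0_def in auto)
    have "\<Delta> x \<noteq> 0" using that by (simp add: U0_def)
    have "d1 x (F w x) = d1 x0 w"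
    proof -
      have "c1 w x * d1 x a1 + c2 w x * d1 x a2 = d1 x0 w - d1 x w"
        unfolding c1_def c2_def using \<open>\<Delta> x \<noteq> 0\<close>
        by (simp add: divide_simps) (simp add: \<Delta>_def algebra_simps)
      then show ?thesis by (simp add: F_def D1.add D1.scaleR)
    qed
    moreover have "d2 x (F w x) = d2 x0 w"
    proof -
      have "c1 w x * d2 x a1 + c2 w x * d2 x a2 = d2 x0 w - d2 x w"
        unfolding c1_def c2_def using \<open>\<Delta> x \<noteq> 0\<close>
        by (simp add: divide_simps) (simp add: \<Delta>_def algebra_simps)
      then show ?thesis by (simp add: F_def D2.add D2.scaleR)
    qed
    moreover have "d1 x0 (F w x) = d1 x0 w + c1 w x" "d2 x0 (F w x) = d2 x0 w + c2 w x"
      using a by (simp_all add: F_def l1.add l2.add l1.scaleR l2.scaleR)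
    ultimately show ?thesis by (simp add: \<phi>'_def F_def)
  qed
  have der_\<phi>: "(\<phi> has_derivative \<phi>' x) (at x)" if "x \<in> S" for x
    unfolding \<phi>_def \<phi>'_def
    by (intro has_derivative_add has_derivative_diff has_derivative_scaleR_left has_derivative_ident
        der_\<rho>1 der_\<rho>2 bounded_linear_imp_has_derivative bounded_linear_d assms that)
  then have bl_\<phi>': "bounded_linear (\<phi>' x)" if "x \<in> S" for x
    using that has_derivative_bounded_linear by blast
  define B where "B x = Blinfun (\<phi>' x)" for x
  have B: "blinfun_apply (B x) = \<phi>' x" if "x \<in> U0" for x
    using bounded_linear_Blinfun_apply[OF bl_\<phi>'] that \<open>U0 \<subseteq> S\<close> by (auto simp: B_def)
  have "continuous_on U0 B"
  proof (rule continuous_on_blinfun_componentwise)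
    fix i :: 'a
    have "smooth_on S (\<lambda>x. \<phi>' x i)"
      unfolding \<phi>'_def by (intro smooth_intros open_S smooth_d)
    then have "continuous_on U0 (\<lambda>x. \<phi>' x i)"
      using smooth_on_imp_continuous_on continuous_on_subset \<open>U0 \<subseteq> S\<close> by blast
    then show "continuous_on U0 (\<lambda>x. blinfun_apply (B x) i)"
      by (rule continuous_on_eq) (simp add: B)
  qed
  have "\<phi>' x0 = (\<lambda>v. v)" by (simp add: \<phi>'_def fun_eq_iff)
  then have id: "id_blinfun o\<^sub>L B x0 = id_blinfun"
    using B[OF \<open>x0 \<in> U0\<close>] by (intro blinfun_eqI) (simp add: blinfun_apply_blinfun_compose)
  have der_B: "(\<phi> has_derivative blinfun_apply (B x)) (at x)" if "x \<in> U0" for x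
    using der_\<phi>[of x] that \<open>U0 \<subseteq> S\<close> B[OF that] by auto
  obtain U W \<psi> \<psi>' where chart: "open U" "U \<subseteq> U0" "x0 \<in> U" "open W" "\<phi> x0 \<in> W" "homeomorphism U W \<phi> \<psi>"
      and der_\<psi>: "\<And>y. y \<in> W \<Longrightarrow> (\<psi> has_derivative \<psi>' y) (at y)"
      and \<psi>': "\<And>y. y \<in> W \<Longrightarrow> \<psi>' y = inv (blinfun_apply (B (\<psi> y)))"
      and bij: "\<And>y. y \<in> W \<Longrightarrow> bij (blinfun_apply (B (\<psi> y)))"
    using inverse_function_theorem[OF \<open>open U0\<close> der_B \<open>continuous_on U0 B\<close> \<open>x0 \<in> U0\<close> id]
    by blast
  have \<psi>_W: "\<psi> ` W \<subseteq> U0" using chart(2,6) by (auto simp: homeomorphism_def)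
  have F: "(\<psi> has_derivative (\<lambda>w. F w (\<psi> y))) (at y)" if "y \<in> W" for y
  proof -
    have y: "\<psi> y \<in> U0" using \<psi>_W that by blast
    have "inj (\<phi>' (\<psi> y))" using bij[OF that] B[OF y] by (simp add: bij_def)
    then have "\<psi>' y w = F w (\<psi> y)" for w
      using \<psi>'[OF that] B[OF y] \<phi>'_F[OF y, of w] by (metis inv_f_f)
    then show ?thesis using der_\<psi>[OF that] by presburger
  qed
  show ?thesis
  proof (rule that[OF chart(1,3) _ chart(4,6)])
    show "U \<subseteq> S" using chart(2) \<open>U0 \<subseteq> S\<close> by blast
    then show "smooth_on U \<phi>" using smooth_\<phi> smooth_on_subset by blast
    show "smooth_on W \<psi>" by (rule smooth_on_bootstrap[OF chart(4) \<open>open U0\<close> \<psi>_W F smooth_F])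
    have "\<psi> (\<phi> x0) = x0" using chart(3,6) by (simp add: homeomorphism_def)
    moreover have "F w x0 = w" for w
      using a by (simp add: F_def c1_def c2_def)
    ultimately show "(\<psi> has_derivative (\<lambda>v. v)) (at (\<phi> x0))"
      using F[OF chart(5)] by simp
    show "d1 x0 (\<phi> x) = \<rho>1 x" "d2 x0 (\<phi> x) = \<rho>2 x" for x
      using a by (simp_all add: \<phi>_def l1.add l2.add l1.scaleR l2.scaleR)
  qed
qed

lemma smooth_submanifold_zero_set:
  assumes "k + 2 = DIM('a)"
  shows "smooth_submanifold k zero_set"
  unfolding smooth_submanifold_def
proof
  fix x assume "x \<in> zero_set"
  then have "x \<in> S" by (simp add: zero_set_def)
  obtain U W \<phi> \<psi> where c: "open U" "x \<in> U" "U \<subseteq> S" "open W" "homeomorphism U W \<phi> \<psi>"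
    "smooth_on U \<phi>" "smooth_on W \<psi>"
    and l: "\<And>y. y \<in> U \<Longrightarrow> d1 x (\<phi> y) = \<rho>1 y" "\<And>y. y \<in> U \<Longrightarrow> d2 x (\<phi> y) = \<rho>2 y"
    using straightening_chart[OF \<open>x \<in> S\<close>] by metis
  interpret D1: bounded_linear "d1 x" by (rule bounded_linear_d[OF \<open>x \<in> S\<close>])
  interpret D2: bounded_linear "d2 x" by (rule bounded_linear_d[OF \<open>x \<in> S\<close>])
  let ?L = "{v. d1 x v = 0 \<and> d2 x v = 0}"
  have "subspace ?L" by (auto simp: subspace_def D1.add D2.add D1.scaleR D2.scaleR)
  moreover have "dim ?L = k" using dim_kernel[OF \<open>x \<in> S\<close>] assms by simp
  moreover have "\<phi> ` (zero_set \<inter> U) = W \<inter> ?L"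
  proof -
    have "y \<in> zero_set \<longleftrightarrow> \<phi> y \<in> ?L" if "y \<in> U" for y
      using l[OF that] that c(3) by (auto simp: zero_set_def)
    moreover have "\<phi> ` U = W" using c(5) by (simp add: homeomorphism_def)
    ultimately show ?thesis by blast
  qed
  ultimately show "\<exists>U W \<phi> \<psi> L. open U \<and> x \<in> U \<and> open W \<and> homeomorphism U W \<phi> \<psi> \<and>
      smooth_on U \<phi> \<and> smooth_on W \<psi> \<and> subspace (L :: 'a set) \<and> dim L = k \<and>
      \<phi> ` (zero_set \<inter> U) = W \<inter> L"
    using c(1,2,4-7)
    by blast
qed

text \<open>A velocity annihilates the differentials because the equations vanish along the curve.
  Conversely, a vector \<open>v\<close> in the kernel is the velocity of the curve that the chart maps to the
  straight line in direction \<open>v\<close>, because the derivative of the chart at \<open>x\<close> is the identity.\<close>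

lemma tangent_space_zero_set:
  assumes "x \<in> zero_set"
  shows "tangent_space zero_set x = {v. d1 x v = 0 \<and> d2 x v = 0}"
proof (intro set_eqI iffI)
  have "x \<in> S" using assms by (simp add: zero_set_def)
  {
    fix v assume "v \<in> tangent_space zero_set x"
    then obtain \<gamma> e where g: "e > 0" "\<gamma> ` {-e<..<e::real} \<subseteq> zero_set" "\<gamma> 0 = x"
      "(\<gamma> has_derivative (\<lambda>t. t *\<^sub>R v)) (at 0)"
      unfolding tangent_space_def has_vector_derivative_def by blast
    have "D v = 0" if "(\<rho> has_derivative D) (at x)" "\<And>y. y \<in> zero_set \<Longrightarrow> \<rho> y = 0"
      for \<rho> :: "'a \<Rightarrow> real" and D
    proof -
      have "((\<lambda>t. \<rho> (\<gamma> t)) has_derivative (\<lambda>t. D (t *\<^sub>R v))) (at 0)"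
        using has_derivative_compose[OF g(4), of \<rho> D] that(1) g(3) by simp
      moreover have "((\<lambda>t. \<rho> (\<gamma> t)) has_derivative (\<lambda>t. 0)) (at 0)"
      proof (rule has_derivative_transform_within_open[of "\<lambda>t. 0" _ _ _ "{-e<..<e}"])
        fix t assume "t \<in> {-e<..<e}"
        then show "0 = \<rho> (\<gamma> t)" using g(2) that(2) by fastforce
      qed (use g(1) in auto)
      ultimately have "(\<lambda>t. D (t *\<^sub>R v)) = (\<lambda>t. 0)" by (rule has_derivative_unique)
      then show ?thesis by (metis scaleR_one)
    qed
    then show "v \<in> {v. d1 x v = 0 \<and> d2 x v = 0}"
      using der_\<rho>1[OF \<open>x \<in> S\<close>] der_\<rho>2[OF \<open>x \<in> S\<close>] by (simp add: zero_set_def)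
  next
    fix v assume "v \<in> {v. d1 x v = 0 \<and> d2 x v = 0}"
    then have v: "d1 x v = 0" "d2 x v = 0" by auto
    obtain U W \<phi> \<psi> where c: "open U" "x \<in> U" "U \<subseteq> S" "open W" "homeomorphism U W \<phi> \<psi>"
      "smooth_on U \<phi>" "smooth_on W \<psi>" "(\<psi> has_derivative (\<lambda>v. v)) (at (\<phi> x))"
      and l: "\<And>y. y \<in> U \<Longrightarrow> d1 x (\<phi> y) = \<rho>1 y" "\<And>y. y \<in> U \<Longrightarrow> d2 x (\<phi> y) = \<rho>2 y"
      using straightening_chart[OF \<open>x \<in> S\<close>] by metis
    interpret D1: bounded_linear "d1 x" by (rule bounded_linear_d[OF \<open>x \<in> S\<close>])
    interpret D2: bounded_linear "d2 x" by (rule bounded_linear_d[OF \<open>x \<in> S\<close>])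
    define line where "line t = \<phi> x + t *\<^sub>R v" for t :: real
    have "\<phi> x \<in> W" using c(2,5) by (auto simp: homeomorphism_def)
    have "continuous_on UNIV line" unfolding line_def by (intro continuous_intros)
    then have "open (line -` W)" by (rule open_vimage[OF \<open>open W\<close>])
    moreover have "0 \<in> line -` W" using \<open>\<phi> x \<in> W\<close> by (simp add: line_def)
    ultimately obtain e where e: "e > 0" "ball 0 e \<subseteq> line -` W" by (rule openE)
    then have line_W: "line ` {-e<..<e} \<subseteq> W" by (auto simp: ball_def dist_real_def subset_iff)
    have "smooth_on {-e<..<e} line"
      unfolding line_def
      by (intro smooth_intros smooth_on_bounded_linear[OF _ bounded_linear_ident]) auto
    then have "smooth_on {-e<..<e} (\<lambda>t. \<psi> (line t))"
      by (intro smooth_on_compose[OF _ \<open>open W\<close> line_W _ c(7)]) auto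
    moreover have "(\<lambda>t. \<psi> (line t)) ` {-e<..<e} \<subseteq> zero_set"
    proof clarify
      fix t assume t: "t \<in> {-e<..<e}"
      have W: "line t \<in> W" using line_W t by blast
      then have U: "\<psi> (line t) \<in> U" and \<phi>: "\<phi> (\<psi> (line t)) = line t"
        using homeomorphism_image2[OF c(5)] homeomorphism_apply2[OF c(5)] by auto
      have "d1 x (line t) = 0" "d2 x (line t) = 0"
        using v l[OF c(2)] assms
        by (simp_all add: line_def zero_set_def D1.add D2.add D1.scaleR D2.scaleR)
      then show "\<psi> (line t) \<in> zero_set" using l[OF U] \<phi> U c(3) by (auto simp: zero_set_def)
    qed
    moreover have "\<psi> (line 0) = x" using c(2,5) by (simp add: line_def homeomorphism_def)
    moreover have "((\<lambda>t. \<psi> (line t)) has_vector_derivative v) (at 0)"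
    proof -
      have "(line has_derivative (\<lambda>t. t *\<^sub>R v)) (at 0)"
        unfolding line_def by (auto intro!: derivative_eq_intros)
      then show ?thesis
        using has_derivative_compose[of line _ 0 UNIV \<psi> "\<lambda>v. v"] c(8)
        unfolding has_vector_derivative_def by (simp add: line_def)
    qed
    ultimately show "v \<in> tangent_space zero_set x"
      unfolding tangent_space_def using e(1) by blast
  }
qed

end

section \<open>Generic zero sets in complex three-space\<close>

text \<open>The complex bilinear (not Hermitian) pairing of a covector with a vector.\<close>

definition cdot :: "complex^3 \<Rightarrow> complex^3 \<Rightarrow> complex" where
  "cdot a v = a$1 * v$1 + a$2 * v$2 + a$3 * v$3"

definition ccross :: "complex^3 \<Rightarrow> complex^3 \<Rightarrow> complex^3" where
  "ccross a b = vector [a$2 * b$3 - a$3 * b$2, a$3 * b$1 - a$1 * b$3, a$1 * b$2 - a$2 * b$1]"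

definition vcnj :: "complex^3 \<Rightarrow> complex^3" where
  "vcnj v = (\<chi> i. cnj (v$i))"

lemma ccross_nth [simp]:
  "ccross a b $ 1 = a$2 * b$3 - a$3 * b$2"
  "ccross a b $ 2 = a$3 * b$1 - a$1 * b$3"
  "ccross a b $ 3 = a$1 * b$2 - a$2 * b$1"
  by (simp_all add: ccross_def)

lemma vcnj_nth [simp]: "vcnj v $ i = cnj (v $ i)"
  by (simp add: vcnj_def)

lemma cdot_linear [simp]:
  "cdot a (v + w) = cdot a v + cdot a w" "cdot a (v - w) = cdot a v - cdot a w"
  "cdot a (c *s v) = c * cdot a v" "cdot a (r *\<^sub>R v) = r *\<^sub>R cdot a v" "cdot a 0 = 0" "cdot a (- v) = - cdot a v"
  by (simp_all add: cdot_def algebra_simps)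

lemma cdot_ccross_self [simp]: "cdot a (ccross a b) = 0" "cdot b (ccross a b) = 0"
  by (simp_all add: cdot_def algebra_simps)

lemma cdot_ccross_rotate: "cdot a (ccross b c) = cdot c (ccross a b)"
  by (simp add: cdot_def algebra_simps)

lemma ccross_ccross: "ccross a (ccross b c) = cdot a c *s b - cdot a b *s c"
  by (simp add: vec_eq_iff forall_3 cdot_def algebra_simps)

lemma cdot_vcnj: "cdot (vcnj v) v = complex_of_real ((norm v)\<^sup>2)"
proof -
  have "(norm v)\<^sup>2 = (\<Sum>i\<in>UNIV. (cmod (v$i))\<^sup>2)"
    by (simp add: norm_vec_def L2_set_def sum_nonneg)
  then show ?thesis
    by (simp add: cdot_def sum_3 complex_norm_square[symmetric] mult.commute)
qed

lemma bounded_bilinear_ccross: "bounded_bilinear ccross"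
  unfolding bilinear_conv_bounded_bilinear[symmetric] bilinear_def
  by (auto intro!: linearI simp: vec_eq_iff forall_3 algebra_simps)

lemma bounded_linear_vcnj: "bounded_linear vcnj"
  unfolding linear_conv_bounded_linear[symmetric]
  by (auto intro!: linearI simp: vec_eq_iff)

lemma bounded_linear_smult: "bounded_linear (\<lambda>v. c *s (v :: complex^'n))"
  unfolding linear_conv_bounded_linear[symmetric]
  by (auto intro!: linearI simp: vec_eq_iff algebra_simps)

lemma bounded_linear_Re_cdot_right: "bounded_linear (\<lambda>a. 2 * Re (cdot a v))"
  unfolding linear_conv_bounded_linear[symmetric]
  by (auto intro!: linearI simp: cdot_def algebra_simps)

lemma complex_smult_decompose: "c *s v = Re c *\<^sub>R v + Im c *\<^sub>R (\<i> *s v)" for v :: "complex^'n"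
  by (simp add: vec_eq_iff complex_eq_iff)

lemma image_lessThan_2: "(\<lambda>i::nat. (if i = 0 then f else g) x) ` {..<2} = {f x, g x}"
  by (auto simp: numeral_2_eq_2 lessThan_Suc)

text \<open>For a real function \<open>\<rho>\<close> the differential is twice the real part of the complex linear form
  \<open>\<partial>\<rho>\<close>; here \<open>\<alpha> = \<partial>\<rho>1\<close> and \<open>\<beta> = \<partial>\<rho>2\<close>. Genericity says that these two forms are linearly
  independent over \<open>\<complex>\<close>, which is stronger than independence of the real differentials.\<close>

locale generic_CR_zero_set =
  fixes S :: "(complex^3) set" and \<rho>1 \<rho>2 :: "complex^3 \<Rightarrow> real" and \<alpha> \<beta> :: "complex^3 \<Rightarrow> complex^3"
  assumes open_domain: "open S"
    and smooth_\<alpha>: "smooth_on S \<alpha>" and smooth_\<beta>: "smooth_on S \<beta>"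
    and deriv_\<rho>1: "x \<in> S \<Longrightarrow> (\<rho>1 has_derivative (\<lambda>v. 2 * Re (cdot (\<alpha> x) v))) (at x)"
    and deriv_\<rho>2: "x \<in> S \<Longrightarrow> (\<rho>2 has_derivative (\<lambda>v. 2 * Re (cdot (\<beta> x) v))) (at x)"
    and generic: "x \<in> S \<Longrightarrow> ccross (\<alpha> x) (\<beta> x) \<noteq> 0"
begin

text \<open>The vector \<open>Z\<close> spans the common complex kernel of \<open>\<alpha>\<close> and \<open>\<beta>\<close>. The vectors \<open>w1\<close>, \<open>w2\<close> form, up to
  the positive factor \<open>\<parallel>Z\<parallel>\<^sup>2\<close>, a basis dual to \<open>\<alpha>\<close>, \<open>\<beta>\<close>, turned by \<open>\<i>\<close>: the factor \<open>\<i>\<close> makes both forms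
  purely imaginary on them, hence makes them tangent. Being polynomial in \<open>\<alpha>\<close>, \<open>\<beta>\<close> and their conjugates,
  these fields are smooth without any normalization.\<close>

definition Z where "Z x = ccross (\<alpha> x) (\<beta> x)"
definition w1 where "w1 x = \<i> *s ccross (\<beta> x) (vcnj (Z x))"
definition w2 where "w2 x = \<i> *s ccross (vcnj (Z x)) (\<alpha> x)"

lemma cdot_Z [simp]: "cdot (\<alpha> x) (Z x) = 0" "cdot (\<beta> x) (Z x) = 0"
  by (simp_all add: Z_def)

lemma cdot_w [simp]:
  "cdot (\<alpha> x) (w1 x) = \<i> * complex_of_real ((norm (Z x))\<^sup>2)" "cdot (\<beta> x) (w1 x) = 0"
  "cdot (\<alpha> x) (w2 x) = 0" "cdot (\<beta> x) (w2 x) = \<i> * complex_of_real ((norm (Z x))\<^sup>2)"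
proof -
  have "cdot (\<alpha> x) (ccross (\<beta> x) (vcnj (Z x))) = cdot (vcnj (Z x)) (Z x)"
    by (simp add: cdot_ccross_rotate Z_def)
  then show "cdot (\<alpha> x) (w1 x) = \<i> * complex_of_real ((norm (Z x))\<^sup>2)"
    by (simp add: w1_def cdot_vcnj)
  have "cdot (\<beta> x) (ccross (vcnj (Z x)) (\<alpha> x)) = cdot (vcnj (Z x)) (Z x)"
    using cdot_ccross_rotate[of "vcnj (Z x)" "\<alpha> x" "\<beta> x"] by (simp add: Z_def)
  then show "cdot (\<beta> x) (w2 x) = \<i> * complex_of_real ((norm (Z x))\<^sup>2)"
    by (simp add: w2_def cdot_vcnj)
  show "cdot (\<beta> x) (w1 x) = 0" "cdot (\<alpha> x) (w2 x) = 0"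
    by (simp_all add: w1_def w2_def)
qed

lemma norm_Z_pos: "x \<in> S \<Longrightarrow> (norm (Z x))\<^sup>2 > 0"
  using generic by (simp add: Z_def)

text \<open>If both forms vanish on \<open>v\<close>, then \<open>v \<times> Z = v \<times> (\<alpha> \<times> \<beta>) = 0\<close> by the triple product formula. Applying
  that formula once more, to the product with the conjugate of \<open>Z\<close>, exhibits \<open>v\<close> as a multiple of \<open>Z\<close>.\<close>

lemma kernel_eq:
  assumes "x \<in> S"
  shows "{v. cdot (\<alpha> x) v = 0 \<and> cdot (\<beta> x) v = 0} = range (\<lambda>c. c *s Z x)"
proof (intro set_eqI iffI)
  fix v assume v: "v \<in> {v. cdot (\<alpha> x) v = 0 \<and> cdot (\<beta> x) v = 0}"
  have comm: "cdot v a = cdot a v" for a by (simp add: cdot_def mult.commute)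
  have "ccross v (Z x) = 0" using v by (simp add: Z_def ccross_ccross comm)
  then have "ccross (vcnj (Z x)) (ccross v (Z x)) = 0"
    by (simp add: vec_eq_iff forall_3)
  then have "cdot (vcnj (Z x)) (Z x) *s v = cdot (vcnj (Z x)) v *s Z x"
    by (simp add: ccross_ccross)
  moreover define n where "n = cdot (vcnj (Z x)) (Z x)"
  moreover have "n \<noteq> 0" using norm_Z_pos[OF assms] by (simp add: n_def cdot_vcnj)
  ultimately have "v = (cdot (vcnj (Z x)) v / n) *s Z x"
    by (simp add: vec_eq_iff field_simps)
  then show "v \<in> range (\<lambda>c. c *s Z x)" by blast
qed auto

sublocale regular_zero_set S \<rho>1 \<rho>2 "\<lambda>x v. 2 * Re (cdot (\<alpha> x) v)" "\<lambda>x v. 2 * Re (cdot (\<beta> x) v)"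
proof
  show "smooth_on S \<rho>1" "smooth_on S \<rho>2"
    by (rule smooth_onI_derivative[OF open_domain deriv_\<rho>1]
          smooth_onI_derivative[OF open_domain deriv_\<rho>2];
        auto intro: smooth_on_bounded_linear_compose[OF open_domain bounded_linear_Re_cdot_right]
          smooth_\<alpha> smooth_\<beta>)+
  fix x assume "x \<in> S"
  \<comment> \<open>The factor undoes the rotation by \<open>\<i>\<close> and the scaling of \<open>w1\<close>, \<open>w2\<close> and the factor 2 of the differentials.\<close>
  define c where "c = - \<i> / complex_of_real (2 * (norm (Z x))\<^sup>2)"
  have half: "c * (\<i> * complex_of_real ((norm (Z x))\<^sup>2)) = 1 / 2"
    using norm_Z_pos[OF \<open>x \<in> S\<close>] by (simp add: c_def field_simps)
  show "\<exists>a1 a2. 2 * Re (cdot (\<alpha> x) a1) = 1 \<and> 2 * Re (cdot (\<beta> x) a1) = 0 \<and>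
      2 * Re (cdot (\<alpha> x) a2) = 0 \<and> 2 * Re (cdot (\<beta> x) a2) = 1"
    by (intro exI[of _ "c *s w1 x"] exI[of _ "c *s w2 x"])
      (simp only: cdot_linear cdot_w half, simp)
qed (use open_domain deriv_\<rho>1 deriv_\<rho>2 in auto)

lemma tangent_space_eq:
  assumes "x \<in> zero_set"
  shows "tangent_space zero_set x = {v. Re (cdot (\<alpha> x) v) = 0 \<and> Re (cdot (\<beta> x) v) = 0}"
  using tangent_space_zero_set[OF assms] by simp

text \<open>Since \<open>Re (cdot a (- \<i> v)) = Im (cdot a v)\<close>, tangency of both \<open>v\<close> and \<open>- \<i> v\<close> means that the complex
  forms themselves vanish on \<open>v\<close>.\<close>

lemma CR_bundle_eq:
  assumes "x \<in> zero_set"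
  shows "CR_bundle zero_set x = {v. cdot (\<alpha> x) v = 0 \<and> cdot (\<beta> x) v = 0}"
proof -
  have "v \<in> cstruct ` T \<longleftrightarrow> - (\<i> *s v) \<in> T" for v :: "complex^3" and T
  proof
    assume "- (\<i> *s v) \<in> T"
    then have "cstruct (- (\<i> *s v)) \<in> cstruct ` T" by blast
    moreover have "cstruct (- (\<i> *s v)) = v"
      by (simp add: cstruct_def vec_eq_iff mult.assoc[symmetric])
    ultimately show "v \<in> cstruct ` T" by simp
  next
    assume "v \<in> cstruct ` T"
    then obtain u where "v = \<i> *s u" "u \<in> T" by (auto simp: cstruct_def)
    moreover from this have "- (\<i> *s v) = u"
      by (simp add: vec_eq_iff mult.assoc[symmetric])
    ultimately show "- (\<i> *s v) \<in> T" by simp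
  qed
  then show ?thesis
    unfolding CR_bundle_def tangent_space_eq[OF assms] set_eq_iff Int_iff
    by (auto simp: complex_eq_iff)
qed

lemma CR_bundle_eq_span:
  assumes "x \<in> zero_set"
  shows "CR_bundle zero_set x = span {Z x, \<i> *s Z x}"
proof -
  have "x \<in> S" using assms by (simp add: zero_set_def)
  have "v \<in> range (\<lambda>c. c *s Z x) \<longleftrightarrow> v \<in> span {Z x, \<i> *s Z x}" for v
  proof
    assume "v \<in> span {Z x, \<i> *s Z x}"
    then obtain s t where "v = s *\<^sub>R Z x + t *\<^sub>R (\<i> *s Z x)" unfolding mem_span_pair by blast
    then have "v = Complex s t *s Z x" by (simp add: complex_smult_decompose[of "Complex s t"])
    then show "v \<in> range (\<lambda>c. c *s Z x)" by blast
  next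
    assume "v \<in> range (\<lambda>c. c *s Z x)"
    then obtain c where "v = c *s Z x" by blast
    then show "v \<in> span {Z x, \<i> *s Z x}"
      unfolding mem_span_pair using complex_smult_decompose[of c "Z x"] by blast
  qed
  then show ?thesis unfolding CR_bundle_eq[OF assms] kernel_eq[OF \<open>x \<in> S\<close>] by blast
qed

lemma smooth_frames:
  "smooth_on S Z" "smooth_on S (\<lambda>x. \<i> *s Z x)" "smooth_on S w1" "smooth_on S w2"
proof -
  show Z: "smooth_on S Z"
    unfolding Z_def by (intro smooth_on_bilinear[OF _ bounded_bilinear_ccross] smooth_\<alpha> smooth_\<beta> open_domain)
  show "smooth_on S (\<lambda>x. \<i> *s Z x)"
    by (rule smooth_on_bounded_linear_compose[OF open_domain bounded_linear_smult Z])
  have "smooth_on S (\<lambda>x. vcnj (Z x))"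
    by (rule smooth_on_bounded_linear_compose[OF open_domain bounded_linear_vcnj Z])
  then show "smooth_on S w1" "smooth_on S w2"
    unfolding w1_def w2_def
    by (auto intro!: smooth_on_bounded_linear_compose[OF open_domain bounded_linear_smult]
        smooth_on_bilinear[OF _ bounded_bilinear_ccross] smooth_\<alpha> smooth_\<beta> open_domain)
qed

lemma smooth_subbundle_pair:
  assumes "smooth_on S f" "smooth_on S g"
    and D: "\<And>x. x \<in> zero_set \<Longrightarrow> D x = span {f x, g x}"
    and "\<And>x. x \<in> zero_set \<Longrightarrow> D x \<subseteq> tangent_space zero_set x"
    and indep: "\<And>x s t. x \<in> zero_set \<Longrightarrow> s *\<^sub>R f x + t *\<^sub>R g x = 0 \<Longrightarrow> s = 0 \<and> t = 0"
  shows "smooth_subbundle 2 zero_set D"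
  unfolding smooth_subbundle_def
proof (intro conjI ballI)
  fix x assume x: "x \<in> zero_set"
  show "D x \<subseteq> tangent_space zero_set x" by (rule assms(4)[OF x])
  show "dim (D x) = 2" unfolding D[OF x] by (rule dim_span_pair[OF indep[OF x]])
  let ?X = "\<lambda>i::nat. if i = 0 then f else g"
  have "open S" "x \<in> S" using open_domain x by (auto simp: zero_set_def)
  moreover have "\<forall>i<2. smooth_on S (?X i)" using assms(1,2) by simp
  moreover have "\<forall>y\<in>zero_set \<inter> S. D y = span ((\<lambda>i. ?X i y) ` {..<2})"
    using D by (simp only: image_lessThan_2) auto
  ultimately show "\<exists>U X. open U \<and> x \<in> U \<and> (\<forall>i<2. smooth_on U (X i)) \<and>
      (\<forall>y\<in>zero_set \<inter> U. D y = span ((\<lambda>i::nat. X i y) ` {..<2}))"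
    by (intro exI[of _ S] exI[of _ ?X] conjI)
qed

text \<open>On the span \<open>V\<close> of \<open>w1\<close>, \<open>w2\<close> the forms \<open>\<alpha>\<close>, \<open>\<beta>\<close> are imaginary and determine the vector. So \<open>V\<close> meets
  the complex kernel in \<open>0\<close> only, and \<open>\<i> V\<close>, where the forms are real, meets the tangent space in \<open>0\<close>
  only. A tangent vector minus the element of \<open>V\<close> with the same values of \<open>\<alpha>\<close> and \<open>\<beta>\<close> is in the complex kernel.\<close>

theorem antiholomorphic_zero_set: "antiholomorphic_CR_submanifold 1 2 zero_set"
proof -
  define V where "V x = span {w1 x, w2 x}" for x
  have in_S: "x \<in> S" if "x \<in> zero_set" for x using that by (simp add: zero_set_def)
  have cdot_V: "\<exists>s t. v = s *\<^sub>R w1 x + t *\<^sub>R w2 x \<and>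
      cdot (\<alpha> x) v = s * \<i> * (norm (Z x))\<^sup>2 \<and> cdot (\<beta> x) v = t * \<i> * (norm (Z x))\<^sup>2"
    if v: "v \<in> V x" for v x
  proof -
    obtain s t where st: "v = s *\<^sub>R w1 x + t *\<^sub>R w2 x"
      using v unfolding V_def mem_span_pair by blast
    have "cdot (\<alpha> x) v = s * \<i> * (norm (Z x))\<^sup>2" "cdot (\<beta> x) v = t * \<i> * (norm (Z x))\<^sup>2"
      unfolding st by (simp_all add: scaleR_conv_of_real[where 'a = complex] mult.assoc)
    then show ?thesis using st by blast
  qed
  have V_zero: "v = 0" if x: "x \<in> zero_set" and v: "v \<in> V x" and "Im (cdot (\<alpha> x) v) = 0" "Im (cdot (\<beta> x) v) = 0" for x v
  proof -
    obtain s t where st: "v = s *\<^sub>R w1 x + t *\<^sub>R w2 x"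
      "cdot (\<alpha> x) v = s * \<i> * (norm (Z x))\<^sup>2" "cdot (\<beta> x) v = t * \<i> * (norm (Z x))\<^sup>2"
      using cdot_V[OF v] by blast
    then have "s * (norm (Z x))\<^sup>2 = 0" "t * (norm (Z x))\<^sup>2 = 0" using that(3,4) by auto
    then show ?thesis using st(1) norm_Z_pos[OF in_S[OF x]] by auto
  qed
  have H: "smooth_subbundle (2 * 1) zero_set (CR_bundle zero_set)"
  proof -
    have "s = 0 \<and> t = 0" if "x \<in> zero_set" "s *\<^sub>R Z x + t *\<^sub>R (\<i> *s Z x) = 0" for x s t
    proof -
      have "Complex s t *s Z x = 0"
        using that(2) by (simp add: complex_smult_decompose[of "Complex s t"])
      then have "Complex s t = 0" using norm_Z_pos[OF in_S[OF that(1)]] by auto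
      then show ?thesis by (simp add: complex_eq_iff)
    qed
    then have "smooth_subbundle 2 zero_set (CR_bundle zero_set)"
      by (intro smooth_subbundle_pair[OF smooth_frames(1,2) CR_bundle_eq_span]) (auto simp: CR_bundle_def)
    then show ?thesis by simp
  qed
  have V_T: "V x \<subseteq> tangent_space zero_set x" if "x \<in> zero_set" for x
    using cdot_V by (fastforce simp: tangent_space_eq[OF that])
  have V: "smooth_subbundle 2 zero_set V"
  proof (rule smooth_subbundle_pair[OF smooth_frames(3,4) V_def V_T])
    fix x s t assume x: "x \<in> zero_set" and 0: "s *\<^sub>R w1 x + t *\<^sub>R w2 x = 0"
    have "cdot (\<alpha> x) (s *\<^sub>R w1 x + t *\<^sub>R w2 x) = 0" "cdot (\<beta> x) (s *\<^sub>R w1 x + t *\<^sub>R w2 x) = 0"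
      unfolding 0 by simp_all
    then show "s = 0 \<and> t = 0" using norm_Z_pos[OF in_S[OF x]] by auto
  qed
  have split: "tangent_space zero_set x = {h + v | h v. h \<in> CR_bundle zero_set x \<and> v \<in> V x}"
    if x: "x \<in> zero_set" for x
  proof (intro set_eqI iffI)
    fix u assume u: "u \<in> tangent_space zero_set x"
    define n where "n = (norm (Z x))\<^sup>2"
    have "n \<noteq> 0" using norm_Z_pos[OF in_S[OF x]] by (simp add: n_def)
    define v where "v = (Im (cdot (\<alpha> x) u) / n) *\<^sub>R w1 x + (Im (cdot (\<beta> x) u) / n) *\<^sub>R w2 x"
    have "v \<in> V x" unfolding V_def mem_span_pair v_def by blast
    moreover have "u - v \<in> CR_bundle zero_set x"
      using u \<open>n \<noteq> 0\<close> unfolding CR_bundle_eq[OF x] tangent_space_eq[OF x]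
      by (simp add: v_def complex_eq_iff n_def[symmetric])
    moreover have "u = (u - v) + v" by simp
    ultimately show "u \<in> {h + v | h v. h \<in> CR_bundle zero_set x \<and> v \<in> V x}" by blast
  next
    fix u assume "u \<in> {h + v | h v. h \<in> CR_bundle zero_set x \<and> v \<in> V x}"
    then obtain h v where "u = h + v" "h \<in> tangent_space zero_set x" "v \<in> tangent_space zero_set x"
      using V_T[OF x] by (auto simp: CR_bundle_def)
    then show "u \<in> tangent_space zero_set x" by (simp add: tangent_space_eq[OF x])
  qed
  have H_V: "CR_bundle zero_set x \<inter> V x = {0}" if x: "x \<in> zero_set" for x
    using V_zero[OF x] by (auto simp: CR_bundle_eq[OF x] V_def span_zero)
  have J_V: "cstruct ` V x \<inter> tangent_space zero_set x = {0}" if x: "x \<in> zero_set" for x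
  proof -
    have "v = 0" if "v \<in> V x" "cstruct v \<in> tangent_space zero_set x" for v
      by (rule V_zero[OF x that(1)]) (use that(2) in \<open>auto simp: tangent_space_eq[OF x] cstruct_def\<close>)
    moreover have "cstruct 0 = 0" by (simp add: cstruct_def vec_eq_iff)
    moreover have "0 \<in> V x" "0 \<in> tangent_space zero_set x"
      by (simp_all add: V_def span_zero tangent_space_eq[OF x])
    ultimately show ?thesis by (auto simp: image_iff)
  qed
  have "smooth_submanifold (2 * 1 + 2) zero_set"
    by (rule smooth_submanifold_zero_set) simp
  then show ?thesis
    unfolding antiholomorphic_CR_submanifold_def
    using H V split H_V J_V by (intro conjI exI[of _ V]) auto
qed

end

section \<open>The cross-ratio variety\<close>

definition modulus_eqn :: "complex^3 \<Rightarrow> real" where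
  "modulus_eqn X = (X$1 \<bullet> X$1) * (X$3 \<bullet> X$3) - X$2 \<bullet> X$2"

definition real_part_eqn :: "complex^3 \<Rightarrow> real" where
  "real_part_eqn X = 2 * (X$1 \<bullet> X$1) * Re (X$3) - X$1 \<bullet> X$1 - X$2 \<bullet> X$2 + 2 * Re (X$1) + 2 * Re (X$2) - 1"

text \<open>The coefficients of \<open>\<partial>modulus_eqn\<close> and \<open>\<partial>real_part_eqn\<close>, that is, of the Wirtinger derivatives with respect
  to \<open>X$1\<close>, \<open>X$2\<close>, \<open>X$3\<close>.\<close>

definition modulus_form :: "complex^3 \<Rightarrow> complex^3" where
  "modulus_form X = vector [cnj (X$1) * (X$3 * cnj (X$3)), - cnj (X$2), X$1 * cnj (X$1) * cnj (X$3)]"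

definition real_part_form :: "complex^3 \<Rightarrow> complex^3" where
  "real_part_form X = vector [cnj (X$1) * (X$3 + cnj (X$3)) - cnj (X$1) + 1, 1 - cnj (X$2), X$1 * cnj (X$1)]"

text \<open>The equations of the singular set with denominators cleared. Removing their solutions from the
  ambient space, and not only from the variety, leaves an open set.\<close>

definition nonsingular :: "(complex^3) set" where
  "nonsingular = {X. X$1 \<noteq> 0 \<and> X$2 \<noteq> 0 \<and> X$3 \<noteq> 0 \<and>
     \<not> (X$1 + X$2 = 1 \<and> X$2 + X$3 = X$2 * X$3 \<and> X$1 * X$3 + 1 = X$1)}"

lemma nth_has_derivative [derivative_intros]:
  "((\<lambda>X. X $ i) has_derivative (\<lambda>v. v $ i)) F"
  by (rule bounded_linear_imp_has_derivative[OF bounded_linear_vec_nth])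

lemma Re_has_derivative_of:
  "(f has_derivative f') F \<Longrightarrow> ((\<lambda>x. Re (f x)) has_derivative (\<lambda>v. Re (f' v))) F"
  by (rule bounded_linear.has_derivative[OF bounded_linear_Re])

lemma modulus_eqn_has_derivative: "(modulus_eqn has_derivative (\<lambda>v. 2 * Re (cdot (modulus_form X) v))) (at X)"
  unfolding modulus_eqn_def
  by (rule derivative_eq_intros refl)+
    (auto simp: fun_eq_iff cdot_def modulus_form_def inner_complex_def algebra_simps)

lemma real_part_eqn_has_derivative: "(real_part_eqn has_derivative (\<lambda>v. 2 * Re (cdot (real_part_form X) v))) (at X)"
  unfolding real_part_eqn_def
  by (rule derivative_eq_intros Re_has_derivative_of refl)+
    (auto simp: fun_eq_iff cdot_def real_part_form_def inner_complex_def algebra_simps)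

lemma smooth_on_vec:
  fixes f :: "'a::euclidean_space \<Rightarrow> complex^'n"
  assumes "open S" "\<And>i. smooth_on S (\<lambda>x. f x $ i)"
  shows "smooth_on S f"
proof -
  have "bounded_linear (axis i :: complex \<Rightarrow> complex^'n)" for i
    unfolding linear_conv_bounded_linear[symmetric]
    by (auto intro!: linearI simp: vec_eq_iff axis_def)
  then have "smooth_on S (\<lambda>x. axis i (f x $ i))" for i
    using smooth_on_bounded_linear_compose[OF assms(1) _ assms(2)] by blast
  then have "smooth_on S (\<lambda>x. \<Sum>i\<in>UNIV. axis i (f x $ i))"
    by (intro smooth_on_sum assms(1))
  moreover have "(\<Sum>i\<in>UNIV. axis i (f x $ i)) = f x" for x
    by (simp add: vec_eq_iff axis_def sum.delta')
  ultimately show ?thesis by simp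
qed

lemma smooth_on_nth [smooth_intros]: "open S \<Longrightarrow> smooth_on S (\<lambda>X::complex^'n. X $ i)"
  by (rule smooth_on_bounded_linear[OF _ bounded_linear_vec_nth])

lemma smooth_on_cnj [smooth_intros]:
  "open S \<Longrightarrow> smooth_on S f \<Longrightarrow> smooth_on S (\<lambda>x. cnj (f x))"
  by (rule smooth_on_bounded_linear_compose[OF _ bounded_linear_cnj])

lemma smooth_forms:
  assumes "open S"
  shows "smooth_on S modulus_form" "smooth_on S real_part_form"
proof -
  show "smooth_on S modulus_form"
  proof (rule smooth_on_vec[OF assms])
    fix i :: 3
    consider "i = 1" | "i = 2" | "i = 3" using exhaust_3 by blast
    then show "smooth_on S (\<lambda>X. modulus_form X $ i)"
      by cases (auto simp: modulus_form_def intro!: smooth_intros assms)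
  qed
  show "smooth_on S real_part_form"
  proof (rule smooth_on_vec[OF assms])
    fix i :: 3
    consider "i = 1" | "i = 2" | "i = 3" using exhaust_3 by blast
    then show "smooth_on S (\<lambda>X. real_part_form X $ i)"
      by cases (auto simp: real_part_form_def intro!: smooth_intros assms)
  qed
qed

lemma open_nonsingular: "open nonsingular"
proof -
  let ?A = "{X::complex^3. X$1 + X$2 = 1 \<and> X$2 + X$3 = X$2 * X$3 \<and> X$1 * X$3 + 1 = X$1}"
  have A: "closed ?A"
    by (intro closed_Collect_conj closed_Collect_eq continuous_intros)
  have nz: "open {X::complex^3. X$i \<noteq> 0}" for i
    by (intro open_Collect_neq continuous_intros)
  have dom: "nonsingular = {X. X$1 \<noteq> 0} \<inter> {X. X$2 \<noteq> 0} \<inter> {X. X$3 \<noteq> 0} - ?A"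
    by (auto simp: nonsingular_def)
  show ?thesis unfolding dom by (intro open_Diff open_Int A nz)
qed

text \<open>Up to nonzero factors the first two components of the cross product are the conjugates of
  \<open>y + z - y z\<close> and \<open>x z + 1 - x\<close>. When both vanish, \<open>z (x + y - 1) = 0\<close> follows. So the forms become
  dependent only where all three equations of the singular set hold.\<close>

lemma generic_on_nonsingular:
  assumes "X \<in> nonsingular"
  shows "ccross (modulus_form X) (real_part_form X) \<noteq> 0"
proof
  assume 0: "ccross (modulus_form X) (real_part_form X) = 0"
  define x y z where "x = X$1" "y = X$2" "z = X$3"
  note xyz = this
  have nz: "x \<noteq> 0" "y \<noteq> 0" "z \<noteq> 0" using assms by (auto simp: nonsingular_def xyz)
  have "ccross (modulus_form X) (real_part_form X) $ 1 = 0" "ccross (modulus_form X) (real_part_form X) $ 2 = 0"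
    unfolding 0 by simp_all
  then have m: "x * cnj x * cnj (y + z - y * z) = 0" "x * cnj x * cnj z * cnj (x * z + 1 - x) = 0"
    by (simp_all add: modulus_form_def real_part_form_def xyz algebra_simps)
  then have yz: "y + z = y * z" and xz: "x * z + 1 = x" using nz by (simp_all del: complex_cnj_add complex_cnj_diff complex_cnj_mult)
  have "z * (x + y - 1) = 0" using yz xz by algebra
  then have "x + y = 1" using nz by simp
  then show False using assms yz xz by (simp add: nonsingular_def xyz)
qed

interpretation cross_ratio: generic_CR_zero_set nonsingular modulus_eqn real_part_eqn modulus_form real_part_form
  by unfold_locales (auto intro: open_nonsingular smooth_forms modulus_eqn_has_derivative real_part_eqn_has_derivative dest: generic_on_nonsingular)

lemma zero_set_eq: "cross_ratio.zero_set = cross_ratio_variety - cross_ratio_CR_singular_set"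
proof -
  have ip: "w \<bullet> w = (cmod w)\<^sup>2" for w :: complex by (simp add: dot_square_norm)
  have mem: "X \<in> cross_ratio.zero_set \<longleftrightarrow> X \<in> nonsingular \<and> modulus_eqn X = 0 \<and> real_part_eqn X = 0" for X
    by (simp add: cross_ratio.zero_set_def)
  have "X \<in> cross_ratio.zero_set \<longleftrightarrow> X \<in> cross_ratio_variety - cross_ratio_CR_singular_set" for X
  proof (cases "X$1 = 0 \<or> X$2 = 0 \<or> X$3 = 0")
    case False
    then have "1 / X$2 + 1 / X$3 = 1 \<longleftrightarrow> X$2 + X$3 = X$2 * X$3" "X$3 + 1 / X$1 = 1 \<longleftrightarrow> X$1 * X$3 + 1 = X$1"
      by (auto simp: field_simps)
    moreover have "(cmod (X$3))\<^sup>2 = (cmod (X$2))\<^sup>2 / (cmod (X$1))\<^sup>2 \<longleftrightarrow> modulus_eqn X = 0"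
      using False by (auto simp: modulus_eqn_def ip field_simps)
    moreover have "2 * (cmod (X $ 1))\<^sup>2 * Re (X $ 3) =
       (cmod (X $ 1))\<^sup>2 + (cmod (X $ 2))\<^sup>2 - 2 * Re (X $ 1) - 2 * Re (X $ 2) + 1 \<longleftrightarrow> real_part_eqn X = 0"
      by (auto simp: real_part_eqn_def ip)
    ultimately show ?thesis
      unfolding mem unfolding cross_ratio_variety_def cross_ratio_CR_singular_set_def nonsingular_def
      using False by simp blast
  next
    case True
    then show ?thesis unfolding mem unfolding cross_ratio_variety_def nonsingular_def by auto
  qed
  then show ?thesis by blast
qed

theorem theorem3p9:
  "antiholomorphic_CR_submanifold 1 2 (cross_ratio_variety - cross_ratio_CR_singular_set)"
  using cross_ratio.antiholomorphic_zero_set unfolding zero_set_eq .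

end
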